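(* Let $(\mathcal X,\langle\cdot,\cdot\rangle)$ be a complex inner-product space, $\mathbb A:\mathcal X\to\mathcal X$ a bijective linear operator and $\mathbb G:\mathcal X\to\mathcal X$ a linear operator. Assume: (H1) $V_c$ is the span of $m$ linearly independent functions $\mathbf p_1,\dots,\mathbf p_m\in\mathcal X$, which define $P:\mathbb C^m\to\mathcal X$, $P\mathbf v=\sum_{k=1}^m(\mathbf v)_k\mathbf p_k$, and $R:\mathcal X\to\mathbb C^m$, $R\mathbf f=[\langle\mathbf p_1,\mathbf f\rangle,\dots,\langle\mathbf p_m,\mathbf f\rangle]^\top$; the matrix $\mathbb A_c:=R\mathbb AP$ is invertible. (H2) $\mathbb A$ and $\mathbb G$ have the same linearly independent eigenvectors $\{\boldsymbol\psi_k\}_{k=1}^\infty$, with corresponding eigenvalues $\widetilde\lambda_k$ of $\mathbb A$ and $\lambda_k$ of $\mathbb G$. (H3) $|\lambda_k|\in(0,1)$ and $|\lambda_k|\le|\lambda_{k-1}|$ for all $k$. (H4) There exists an index $\widetilde m\ge m$ such that $V_c\subseteq\mathrm{span}\{\boldsymbol\psi_k\}_{k=1}^{\widetilde m}$ and $V_c\cap\mathrm{span}\{\boldsymbol\psi_k\}_{k=\widetilde m+1}^\infty=\{0\}$. Assume further that $\{\boldsymbol\psi_k\}_{k=1}^\infty$ is an orthonormal basis with respect to an inner product $(\!(\cdot,\cdot)\!)$ (not necessarily equal to $\langle\cdot,\cdot\rangle$) such that $(\mathcal X,(\!(\cdot,\cdot)\!))$ is a Hilbert space, and that $\mathbb A$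 and $\mathbb G$ are bounded and self-adjoint with respect to $(\!(\cdot,\cdot)\!)$. Let $\mathbb T:=(\mathbb I-P\mathbb A_c^{-1}R\mathbb A)\mathbb G$, and let $\widetilde T_{\widetilde m}\in\mathbb C^{\widetilde m\times\widetilde m}$ be the matrix of coefficients $\widetilde t_{j,\ell}$ defined by $\mathbb T\boldsymbol\psi_j=\sum_{\ell=1}^{\widetilde m}\widetilde t_{j,\ell}\boldsymbol\psi_\ell$, $j=1,\dots,\widetilde m$. If $\widetilde T_{\widetilde m}$ is nilpotent (e.g., if $V_c=\mathrm{span}\{\boldsymbol\psi_k\}_{k=1}^{\widetilde m}$), then $$\rho(\mathbb T):=\lim_{n\to\infty}\|\mathbb T^n\|_{\mathcal X}^{1/n}=|\lambda_{\widetilde m+1}|<1.$$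
   Context: $\mathbb I$ is the identity on $\mathcal X$. The inner product $\langle\cdot,\cdot\rangle$ is linear in its second argument. $\|\cdot\|_{\mathcal X}$ is the norm induced by $(\!(\cdot,\cdot)\!)$ and, for operators, $\|S\|_{\mathcal X}:=\sup_{\|\mathbf v\|_{\mathcal X}=1}\|S\mathbf v\|_{\mathcal X}$. The operator $\mathbb T$ is taken to be bounded in this norm. By (H1), (H2) and (H4), $\mathrm{span}\{\boldsymbol\psi_k\}_{k=1}^{\widetilde m}$ is invariant under $\mathbb T$, so the coefficients $\widetilde t_{j,\ell}$ are well defined. *)

theory Defs
  imports "HOL-Analysis.Analysis" "Jordan_Normal_Form.Matrix"
begin

(* Both libraries use "$"; here it is the component of a vector of type complex ^ 'm. *)
no_notation vec_index (infixl "$" 100)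

section \<open>Complex inner product spaces\<close>

text \<open>
  The space is the whole type \<open>'a\<close> with scalar multiplication \<open>cscale\<close>. Because two inner products
  live on the same space, the inner product is a parameter and not a type class operation. It is
  linear in its second argument.
\<close>

locale complex_inner_product_space = vector_space cscale
  for cscale :: "complex \<Rightarrow> 'a::ab_group_add \<Rightarrow> 'a"
    and ip :: "'a \<Rightarrow> 'a \<Rightarrow> complex" +
  assumes ip_add_right: "ip x (y + z) = ip x y + ip x z"
    and ip_scale_right: "ip x (cscale c y) = c * ip x y"
    and ip_cnj_commute: "ip y x = cnj (ip x y)"
    and ip_self_nonneg: "0 \<le> Re (ip x x)"
    and ip_self_eq_0: "ip x x = 0 \<Longrightarrow> x = 0"

definition ip_norm :: "('a \<Rightarrow> 'a \<Rightarrow> complex) \<Rightarrow> 'a \<Rightarrow> real"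
  where "ip_norm ip x = sqrt (Re (ip x x))"

definition ip_dist :: "('a::ab_group_add \<Rightarrow> 'a \<Rightarrow> complex) \<Rightarrow> 'a \<Rightarrow> 'a \<Rightarrow> real"
  where "ip_dist ip x y = ip_norm ip (x - y)"

locale complex_hilbert_space = complex_inner_product_space cscale ip
  for cscale :: "complex \<Rightarrow> 'a::ab_group_add \<Rightarrow> 'a"
    and ip :: "'a \<Rightarrow> 'a \<Rightarrow> complex" +
  assumes ip_complete: "Metric_space.mcomplete UNIV (ip_dist ip)"

definition orthonormal_basis ::
    "(complex \<Rightarrow> 'a::ab_group_add \<Rightarrow> 'a) \<Rightarrow> ('a \<Rightarrow> 'a \<Rightarrow> complex) \<Rightarrow> 'i set \<Rightarrow> ('i \<Rightarrow> 'a) \<Rightarrow> bool"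
  where "orthonormal_basis cscale ip I e \<longleftrightarrow>
    (\<forall>i\<in>I. \<forall>j\<in>I. ip (e i) (e j) = (if i = j then 1 else 0)) \<and>
    (Metric_space.mtopology UNIV (ip_dist ip)) closure_of (module.span cscale (e ` I)) = UNIV"

definition linearly_independent_family ::
    "(complex \<Rightarrow> 'a::ab_group_add \<Rightarrow> 'a) \<Rightarrow> 'i set \<Rightarrow> ('i \<Rightarrow> 'a) \<Rightarrow> bool"
  where "linearly_independent_family cscale I e \<longleftrightarrow>
    inj_on e I \<and> \<not> module.dependent cscale (e ` I)"

definition bounded_op :: "('a \<Rightarrow> 'a \<Rightarrow> complex) \<Rightarrow> ('a \<Rightarrow> 'a) \<Rightarrow> bool"
  where "bounded_op ip S \<longleftrightarrow> (\<exists>C. \<forall>v. ip_norm ip (S v) \<le> C * ip_norm ip v)"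

text \<open>The supremum is taken in \<open>real\<close>, so it is meaningful only for bounded operators.\<close>

definition op_norm :: "('a \<Rightarrow> 'a \<Rightarrow> complex) \<Rightarrow> ('a \<Rightarrow> 'a) \<Rightarrow> real"
  where "op_norm ip S = (SUP v\<in>{v. ip_norm ip v = 1}. ip_norm ip (S v))"

definition self_adjoint_op :: "('a \<Rightarrow> 'a \<Rightarrow> complex) \<Rightarrow> ('a \<Rightarrow> 'a) \<Rightarrow> bool"
  where "self_adjoint_op ip S \<longleftrightarrow> (\<forall>x y. ip (S x) y = ip x (S y))"

section \<open>The two-level operator\<close>

text \<open>
  The coarse functions \<open>p\<^sub>1, \<dots>, p\<^sub>m\<close> are indexed by a finite type \<open>'m\<close> with \<open>m = CARD('m)\<close>.
\<close>

definition prolongation ::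
    "(complex \<Rightarrow> 'a::ab_group_add \<Rightarrow> 'a) \<Rightarrow> ('m::finite \<Rightarrow> 'a) \<Rightarrow> complex ^ 'm \<Rightarrow> 'a"
  where "prolongation cscale p v = (\<Sum>k\<in>UNIV. cscale (v $ k) (p k))"

definition restriction ::
    "('a \<Rightarrow> 'a \<Rightarrow> complex) \<Rightarrow> ('m::finite \<Rightarrow> 'a) \<Rightarrow> 'a \<Rightarrow> complex ^ 'm"
  where "restriction ip p f = (\<chi> k. ip (p k) f)"

definition coarse_matrix ::
    "(complex \<Rightarrow> 'a::ab_group_add \<Rightarrow> 'a) \<Rightarrow> ('a \<Rightarrow> 'a \<Rightarrow> complex) \<Rightarrow> ('m::finite \<Rightarrow> 'a) \<Rightarrow> ('a \<Rightarrow> 'a)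
      \<Rightarrow> complex ^ 'm ^ 'm"
  where "coarse_matrix cscale ip p A = matrix (restriction ip p \<circ> A \<circ> prolongation cscale p)"

definition two_level_op ::
    "(complex \<Rightarrow> 'a::ab_group_add \<Rightarrow> 'a) \<Rightarrow> ('a \<Rightarrow> 'a \<Rightarrow> complex) \<Rightarrow> ('m::finite \<Rightarrow> 'a) \<Rightarrow> ('a \<Rightarrow> 'a)
      \<Rightarrow> ('a \<Rightarrow> 'a) \<Rightarrow> 'a \<Rightarrow> 'a"
  where "two_level_op cscale ip p A G f =
    G f - prolongation cscale p
            (matrix_inv (coarse_matrix cscale ip p A) *v restriction ip p (A (G f)))"

text \<open>
  The \<open>n \<times> n\<close> matrix of coefficients \<open>t\<^sub>j\<^sub>l\<close> with \<open>S \<psi>\<^sub>j = (\<Sum>l=1..n. t\<^sub>j\<^sub>l \<psi>\<^sub>l)\<close>: row \<open>j\<close> holds the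
  coordinates of \<open>S \<psi>\<^sub>j\<close>. Vectors are numbered from \<open>1\<close>, matrix entries from \<open>0\<close>.
\<close>

definition coefficient_matrix ::
    "(complex \<Rightarrow> 'a::ab_group_add \<Rightarrow> 'a) \<Rightarrow> (nat \<Rightarrow> 'a) \<Rightarrow> nat \<Rightarrow> ('a \<Rightarrow> 'a) \<Rightarrow> complex mat"
  where "coefficient_matrix cscale \<psi> n S =
    mat n n (\<lambda>(j, l). module.representation cscale (\<psi> ` {1..n}) (S (\<psi> (Suc j))) (\<psi> (Suc l)))"

lemma coefficient_matrix_expansion:
  fixes cscale :: "complex \<Rightarrow> 'a::ab_group_add \<Rightarrow> 'a"
  assumes vs: "vector_space cscale"
    and ind: "linearly_independent_family cscale {1..n} \<psi>"
    and inv: "S (\<psi> j) \<in> module.span cscale (\<psi> ` {1..n})"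
    and j: "j \<in> {1..n}"
  shows "S (\<psi> j) =
    (\<Sum>l=1..n. cscale (coefficient_matrix cscale \<psi> n S $$ (j - 1, l - 1)) (\<psi> l))"
proof -
  interpret vector_space cscale by (rule vs)
  have inj: "inj_on \<psi> {1..n}" and indep: "independent (\<psi> ` {1..n})"
    using ind by (auto simp: linearly_independent_family_def)
  have "S (\<psi> j) = (\<Sum>b\<in>\<psi> ` {1..n}. cscale (representation (\<psi> ` {1..n}) (S (\<psi> j)) b) b)"
    using sum_representation_eq[OF indep inv] by simp
  also have "\<dots> = (\<Sum>l=1..n. cscale (representation (\<psi> ` {1..n}) (S (\<psi> j)) (\<psi> l)) (\<psi> l))"
    by (subst sum.reindex[OF inj]) simp
  also have "\<dots> = (\<Sum>l=1..n. cscale (coefficient_matrix cscale \<psi> n S $$ (j - 1, l - 1)) (\<psi> l))"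
    using j by (intro sum.cong) (auto simp: coefficient_matrix_def)
  finally show ?thesis .
qed

definition nilpotent_mat :: "complex mat \<Rightarrow> bool"
  where "nilpotent_mat M \<longleftrightarrow> (\<exists>k. M ^\<^sub>m k = 0\<^sub>m (dim_row M) (dim_row M))"

end

theory Submission
  imports Defs
begin

text \<open>
  Write \<open>W\<close> for the span of \<open>\<psi>\<^sub>1, \<dots>, \<psi>\<^sub>m\<^sub>t\<close>. The correction subtracted from \<open>G\<close> in the two-level operator
  \<open>T\<close> takes its values in \<open>V\<^sub>c \<subseteq> W\<close>, so \<open>T\<close> and \<open>G\<close> agree modulo \<open>W\<close>, and \<open>W\<close> is invariant under both.
  Relative to the decomposition into \<open>W\<close> and its orthogonal complement, \<open>T\<close> is therefore block
  triangular: one diagonal block is \<open>T\<close> on \<open>W\<close>, whose matrix is assumed nilpotent, and the other is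
  \<open>G\<close> on the complement, a diagonal operator of norm \<open>r = \<bar>\<lambda>\<^sub>m\<^sub>t\<^sub>+\<^sub>1\<bar>\<close>.

  The limit is obtained from a two-sided estimate of \<open>\<parallel>T\<^sup>n\<parallel>\<close> by multiples of \<open>r\<^sup>n\<close>.
  For the lower bound, \<open>T\<^sup>n \<psi>\<^sub>m\<^sub>t\<^sub>+\<^sub>1\<close> differs from \<open>\<lambda>\<^sub>m\<^sub>t\<^sub>+\<^sub>1\<^sup>n \<psi>\<^sub>m\<^sub>t\<^sub>+\<^sub>1\<close> by an element of \<open>W\<close>, which is orthogonal to
  \<open>\<psi>\<^sub>m\<^sub>t\<^sub>+\<^sub>1\<close>; hence its norm is at least \<open>r\<^sup>n\<close>. For the upper bound, let \<open>T\<^sup>K\<close> vanish on \<open>W\<close> and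
  let \<open>s = w + u\<close> be a finite combination of basis vectors, with \<open>w \<in> W\<close> and \<open>u\<close> in the span of the
  remaining ones. Since \<open>T\<^sup>n s\<close> and \<open>G\<^sup>n u\<close> agree modulo \<open>W\<close>, \<open>T\<^sup>n\<^sup>+\<^sup>K s = T\<^sup>K G\<^sup>n u\<close>, whose norm is at most
  \<open>C\<^sup>K r\<^sup>n \<parallel>u\<parallel> \<le> C\<^sup>K r\<^sup>n \<parallel>s\<parallel>\<close> with \<open>C\<close> a bound of \<open>T\<close>; boundedness of \<open>T\<close> extends this to the closure
  of the finite combinations, which is the whole space. The estimate is
  \<open>op_norm_funpow_two_sided\<close>, and taking \<open>n\<close>-th roots removes the constant.

  If \<open>V\<^sub>c = W\<close>, then the correction cancels \<open>G w \<in> W\<close> for every \<open>w \<in> W\<close>, so \<open>T\<close> vanishes on \<open>W\<close> and its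
  matrix is \<open>0\<close>.
\<close>

section \<open>Iterates of linear maps\<close>

lemma linear_funpow:
  assumes "Vector_Spaces.linear s s S"
  shows "Vector_Spaces.linear s s (S ^^ n)"
proof (induction n)
  case 0
  interpret Vector_Spaces.linear s s S by fact
  show ?case by (simp add: Vector_Spaces.linear_iff vs1.vector_space_axioms)
next
  case (Suc n)
  then show ?case
    using Vector_Spaces.linear_compose[OF Suc assms] by (simp add: o_def)
qed

lemma linear_map_add: "Vector_Spaces.linear s t S \<Longrightarrow> S (x + y) = S x + S y"
  by (simp add: Vector_Spaces.linear_iff)

lemma linear_map_scale: "Vector_Spaces.linear s t S \<Longrightarrow> S (s c x) = t c (S x)"
  by (simp add: Vector_Spaces.linear_iff)

lemma linear_map_zero:
  assumes "Vector_Spaces.linear s t S"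
  shows "S 0 = 0"
proof -
  interpret Vector_Spaces.linear s t S by fact
  show ?thesis by (rule zero)
qed

lemma linear_map_sum:
  assumes "Vector_Spaces.linear s t S"
  shows "S (\<Sum>i\<in>I. s (c i) (x i)) = (\<Sum>i\<in>I. t (c i) (S (x i)))"
proof -
  interpret Vector_Spaces.linear s t S by fact
  show ?thesis by (simp add: sum scale)
qed

lemma (in vector_space) linear_span_invariant:
  assumes S: "Vector_Spaces.linear scale scale S"
    and B: "\<And>b. b \<in> B \<Longrightarrow> S b \<in> span B"
    and x: "x \<in> span B"
  shows "S x \<in> span B"
  using x
proof (induction rule: span_induct_alt)
  case base
  then show ?case by (simp add: linear_map_zero[OF S] span_zero)
next
  case (step c b y)
  then show ?case
    by (simp add: linear_map_add[OF S] linear_map_scale[OF S] span_add span_scale B)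
qed

lemma funpow_invariant:
  assumes "\<And>x. x \<in> U \<Longrightarrow> S x \<in> U" and "x \<in> U"
  shows "(S ^^ n) x \<in> U"
  using assms by (induction n) auto

lemma (in vector_space) span_image_eq_sum:
  assumes "x \<in> span (e ` I)"
  obtains F c where "finite F" "F \<subseteq> I" "x = (\<Sum>i\<in>F. scale (c i) (e i))"
proof -
  obtain t r where t: "finite t" "t \<subseteq> e ` I" "x = (\<Sum>a\<in>t. scale (r a) a)"
    using assms unfolding span_explicit by blast
  obtain F where F: "F \<subseteq> I" "inj_on e F" "t = e ` F"
    using t(2) by (metis subset_image_inj)
  have "finite F"
    using F t(1) finite_imageD by blast
  have "x = (\<Sum>i\<in>F. scale (r (e i)) (e i))"
    unfolding t(3) F(3) by (subst sum.reindex[OF F(2)]) simp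
  with \<open>finite F\<close> F(1) show thesis
    by (rule that)
qed

text \<open>
  On the quotient by the \<open>S\<close>-invariant subspace \<open>span B\<close> both maps induce the same map, hence so do
  their iterates.
\<close>

lemma (in vector_space) funpow_diff_in_span:
  assumes S: "Vector_Spaces.linear scale scale S"
    and diff: "\<And>x. S x - G x \<in> span B"
    and inv: "\<And>x. x \<in> span B \<Longrightarrow> S x \<in> span B"
  shows "(S ^^ n) x - (G ^^ n) x \<in> span B"
proof (induction n)
  case 0
  then show ?case by (simp add: span_zero)
next
  case (Suc n)
  interpret S: Vector_Spaces.linear scale scale S by (rule S)
  let ?g = "(G ^^ n) x" and ?s = "(S ^^ n) x"
  have "S (?s - ?g) + (S ?g - G ?g) \<in> span B"
    by (intro span_add inv Suc diff)
  then show ?case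
    by (simp add: S.diff)
qed

section \<open>Norm and metric of a complex inner product\<close>

context complex_inner_product_space
begin

lemma ip_zero_right [simp]: "ip x 0 = 0"
  using ip_scale_right[of x 0 0] by simp

lemma ip_zero_left [simp]: "ip 0 x = 0"
  using ip_cnj_commute[of x 0] by simp

lemma ip_add_left: "ip (x + y) z = ip x z + ip y z"
  by (metis ip_add_right ip_cnj_commute complex_cnj_add)

lemma ip_scale_left: "ip (cscale c x) y = cnj c * ip x y"
  by (metis ip_scale_right ip_cnj_commute complex_cnj_mult)

lemma ip_minus_right: "ip x (- y) = - ip x y"
  using ip_scale_right[of x "-1" y] by simp

lemma ip_minus_left: "ip (- x) y = - ip x y"
  using ip_scale_left[of "-1" x y] by simp

lemma ip_diff_right: "ip x (y - z) = ip x y - ip x z"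
  using ip_add_right[of x y "- z"] by (simp add: ip_minus_right)

lemma ip_diff_left: "ip (x - y) z = ip x z - ip y z"
  using ip_add_left[of x "- y" z] by (simp add: ip_minus_left)

lemma ip_sum_right: "ip x (\<Sum>i\<in>F. f i) = (\<Sum>i\<in>F. ip x (f i))"
  by (induction F rule: infinite_finite_induct) (auto simp: ip_add_right)

lemma ip_sum_left: "ip (\<Sum>i\<in>F. f i) x = (\<Sum>i\<in>F. ip (f i) x)"
  by (induction F rule: infinite_finite_induct) (auto simp: ip_add_left)

lemma Re_ip_commute: "Re (ip y x) = Re (ip x y)"
  using ip_cnj_commute[of x y] by simp

lemma ip_norm_nonneg [simp]: "0 \<le> ip_norm ip x"
  by (simp add: ip_norm_def ip_self_nonneg)

lemma ip_norm_power2: "(ip_norm ip x)\<^sup>2 = Re (ip x x)"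
  by (simp add: ip_norm_def ip_self_nonneg)

lemma ip_norm_eq_0_iff: "ip_norm ip x = 0 \<longleftrightarrow> x = 0"
proof
  assume "ip_norm ip x = 0"
  then have "Re (ip x x) = 0"
    by (simp add: ip_norm_def)
  moreover have "Im (ip x x) = 0"
    using arg_cong[OF ip_cnj_commute[of x x], of Im] by simp
  ultimately show "x = 0"
    by (intro ip_self_eq_0 complex_eqI) auto
qed (simp add: ip_norm_def)

lemma ip_norm_scale: "ip_norm ip (cscale c x) = cmod c * ip_norm ip x"
proof -
  have "ip (cscale c x) (cscale c x) = (cnj c * c) * ip x x"
    by (simp add: ip_scale_left ip_scale_right)
  also have "cnj c * c = complex_of_real ((cmod c)\<^sup>2)"
    by (metis complex_norm_square mult.commute)
  finally show ?thesis
    by (simp add: ip_norm_def real_sqrt_mult)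
qed

lemma ip_norm_uminus: "ip_norm ip (- x) = ip_norm ip x"
  by (simp add: ip_norm_def ip_minus_left ip_minus_right)

lemma Re_ip_le: "Re (ip x y) \<le> ip_norm ip x * ip_norm ip y"
proof (cases "x = 0 \<or> y = 0")
  case False
  define a where "a = ip_norm ip x"
  define b where "b = ip_norm ip y"
  have pos: "0 < a * b"
    using False ip_norm_eq_0_iff ip_norm_nonneg unfolding a_def b_def
    by (metis less_eq_real_def mult_pos_pos)
  \<comment> \<open>Rescaled to equal length, \<open>x\<close> and \<open>y\<close> have a difference with square norm \<open>2ab (ab - Re \<langle>x, y\<rangle>)\<close>.\<close>
  let ?z = "cscale b x - cscale a y"
  have "0 \<le> Re (ip ?z ?z)"
    by (rule ip_self_nonneg)
  also have "\<dots> = b * b * Re (ip x x) + a * a * Re (ip y y) - 2 * a * b * Re (ip x y)"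
    by (simp add: ip_diff_left ip_diff_right ip_scale_left ip_scale_right Re_ip_commute[of x y]
        algebra_simps)
  also have "\<dots> = 2 * (a * b) * (a * b - Re (ip x y))"
    by (simp add: ip_norm_power2[symmetric] a_def b_def power2_eq_square algebra_simps)
  finally have "0 \<le> a * b - Re (ip x y)"
    using pos by (simp add: zero_le_mult_iff)
  then show ?thesis
    by (simp add: a_def b_def)
qed auto

lemma ip_norm_triangle: "ip_norm ip (x + y) \<le> ip_norm ip x + ip_norm ip y"
proof (rule power2_le_imp_le)
  have "(ip_norm ip (x + y))\<^sup>2 = (ip_norm ip x)\<^sup>2 + (ip_norm ip y)\<^sup>2 + 2 * Re (ip x y)"
    by (simp add: ip_norm_power2 ip_add_left ip_add_right Re_ip_commute[of x y])
  also have "\<dots> \<le> (ip_norm ip x + ip_norm ip y)\<^sup>2"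
    using Re_ip_le[of x y] by (simp add: power2_sum)
  finally show "(ip_norm ip (x + y))\<^sup>2 \<le> (ip_norm ip x + ip_norm ip y)\<^sup>2" .
qed simp

lemma Metric_space_ip_dist: "Metric_space UNIV (ip_dist ip)"
proof
  fix x y z
  show "0 \<le> ip_dist ip x y"
    by (simp add: ip_dist_def)
  show "ip_dist ip x y = ip_dist ip y x"
    using ip_norm_uminus[of "x - y"] by (simp add: ip_dist_def)
  show "ip_dist ip x y = 0 \<longleftrightarrow> x = y"
    by (simp add: ip_dist_def ip_norm_eq_0_iff)
  show "ip_dist ip x z \<le> ip_dist ip x y + ip_dist ip y z"
    using ip_norm_triangle[of "x - y" "y - z"] by (simp add: ip_dist_def)
qed

lemma ip_norm_le_orthogonal_add:
  assumes "ip u w = 0"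
  shows "ip_norm ip u \<le> ip_norm ip (w + u)"
proof (rule power2_le_imp_le)
  have "ip w u = 0"
    using assms ip_cnj_commute[of w u] by simp
  then show "(ip_norm ip u)\<^sup>2 \<le> (ip_norm ip (w + u))\<^sup>2"
    using assms by (simp add: ip_norm_power2 ip_add_left ip_add_right ip_self_nonneg)
qed simp

lemma ip_span_eq_0:
  assumes "\<And>b b'. b \<in> B \<Longrightarrow> b' \<in> B' \<Longrightarrow> ip b b' = 0" and "x \<in> span B" and "y \<in> span B'"
  shows "ip x y = 0"
proof -
  have "ip b y = 0" if "b \<in> B" for b
    using assms(3) by (induction rule: span_induct_alt)
      (use that assms(1) in \<open>auto simp: ip_add_right ip_scale_right\<close>)
  note left = this
  show ?thesis
    using assms(2) by (induction rule: span_induct_alt) (auto simp: ip_add_left ip_scale_left left)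
qed

section \<open>Operators with respect to an inner product norm\<close>

lemma bounded_op_pos:
  assumes "bounded_op ip S"
  obtains C where "0 < C" "\<And>v. ip_norm ip (S v) \<le> C * ip_norm ip v"
proof -
  obtain C where C: "\<And>v. ip_norm ip (S v) \<le> C * ip_norm ip v"
    using assms by (auto simp: bounded_op_def)
  have "ip_norm ip (S v) \<le> max C 1 * ip_norm ip v" for v
    using C[of v] mult_right_mono[OF max.cobounded1 ip_norm_nonneg] by (rule order_trans)
  then show thesis
    using that[of "max C 1"] by simp
qed

lemma ip_norm_funpow_le:
  assumes "\<And>v. v \<in> U \<Longrightarrow> S v \<in> U" and "\<And>v. v \<in> U \<Longrightarrow> ip_norm ip (S v) \<le> C * ip_norm ip v"
    and "0 \<le> C" and "v \<in> U"
  shows "ip_norm ip ((S ^^ n) v) \<le> C ^ n * ip_norm ip v"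
proof (induction n)
  case (Suc n)
  have "ip_norm ip ((S ^^ Suc n) v) \<le> C * ip_norm ip ((S ^^ n) v)"
    using assms(2)[OF funpow_invariant[of U S v n, OF assms(1,4)]] by simp
  also have "\<dots> \<le> C * (C ^ n * ip_norm ip v)"
    by (intro mult_left_mono Suc assms(3))
  finally show ?case by (simp add: mult.assoc)
qed simp

lemma op_norm_le:
  assumes "\<And>v. ip_norm ip (S v) \<le> B * ip_norm ip v" and "ip_norm ip e = 1"
  shows "op_norm ip S \<le> B"
  unfolding op_norm_def
proof (rule cSUP_least)
  show "{v. ip_norm ip v = 1} \<noteq> {}"
    using assms(2) by blast
  show "ip_norm ip (S v) \<le> B" if "v \<in> {v. ip_norm ip v = 1}" for v
    using assms(1)[of v] that by simp
qed

lemma le_op_norm: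
  assumes "\<And>v. ip_norm ip (S v) \<le> B * ip_norm ip v" and "ip_norm ip e = 1"
  shows "ip_norm ip (S e) \<le> op_norm ip S"
  unfolding op_norm_def
proof (rule cSUP_upper)
  have "ip_norm ip (S v) \<le> B" if "ip_norm ip v = 1" for v
    using assms(1)[of v] that by simp
  then show "bdd_above ((\<lambda>v. ip_norm ip (S v)) ` {v. ip_norm ip v = 1})"
    by (intro bdd_aboveI[of _ B]) auto
qed (use assms(2) in simp)

text \<open>
  Some bound of \<open>S\<close> on the whole space makes \<open>S\<close> continuous; this is what carries the sharper
  bound from the dense set to its closure.
\<close>

lemma bound_on_dense_extends:
  assumes S: "Vector_Spaces.linear cscale cscale S"
    and bdd: "\<And>v. ip_norm ip (S v) \<le> C * ip_norm ip v" and C: "0 \<le> C"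
    and dense: "Metric_space.mtopology UNIV (ip_dist ip) closure_of D = UNIV"
    and D: "\<And>v. v \<in> D \<Longrightarrow> ip_norm ip (S v) \<le> B * ip_norm ip v" and B: "0 \<le> B"
  shows "ip_norm ip (S x) \<le> B * ip_norm ip x"
proof (rule field_le_epsilon)
  fix \<epsilon> :: real
  assume "0 < \<epsilon>"
  define \<delta> where "\<delta> = \<epsilon> / (B + C + 1)"
  have pos: "0 < B + C + 1" "0 < \<delta>"
    using B C \<open>0 < \<epsilon>\<close> by (auto simp: \<delta>_def)
  interpret M: Metric_space UNIV "ip_dist ip" by (rule Metric_space_ip_dist)
  have "x \<in> M.mtopology closure_of D"
    using dense by simp
  then obtain s where s: "s \<in> D" "ip_norm ip (x - s) < \<delta>"
    using pos(2) unfolding M.metric_closure_of by (auto simp: ip_dist_def)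
  have "ip_norm ip (S x) \<le> ip_norm ip (S s) + ip_norm ip (S (x - s))"
    using ip_norm_triangle[of "S s" "S (x - s)"] linear_map_add[OF S, of s "x - s"] by simp
  also have "\<dots> \<le> B * ip_norm ip s + C * ip_norm ip (x - s)"
    by (intro add_mono D s bdd)
  also have "ip_norm ip s \<le> ip_norm ip x + ip_norm ip (x - s)"
    using ip_norm_triangle[of x "s - x"] ip_norm_uminus[of "x - s"] by simp
  then have "B * ip_norm ip s + C * ip_norm ip (x - s)
      \<le> B * (ip_norm ip x + ip_norm ip (x - s)) + C * ip_norm ip (x - s)"
    using B by (simp add: mult_left_mono)
  also have "\<dots> = B * ip_norm ip x + (B + C) * ip_norm ip (x - s)"
    by (simp add: algebra_simps)
  also have "(B + C) * ip_norm ip (x - s) \<le> (B + C + 1) * \<delta>"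
    using s(2) B C by (intro mult_mono) auto
  also have "(B + C + 1) * \<delta> = \<epsilon>"
    using pos by (simp add: \<delta>_def)
  finally show "ip_norm ip (S x) \<le> B * ip_norm ip x + \<epsilon>"
    by simp
qed

section \<open>Operators that are diagonal modulo an invariant subspace\<close>

lemma ip_norm_orthonormal_sum:
  assumes "finite F" and "\<And>i j. i \<in> F \<Longrightarrow> j \<in> F \<Longrightarrow> ip (e i) (e j) = (if i = j then 1 else 0)"
  shows "(ip_norm ip (\<Sum>i\<in>F. cscale (c i) (e i)))\<^sup>2 = (\<Sum>i\<in>F. (cmod (c i))\<^sup>2)"
proof -
  have "ip (\<Sum>i\<in>F. cscale (c i) (e i)) (\<Sum>i\<in>F. cscale (c i) (e i))
      = (\<Sum>i\<in>F. \<Sum>j\<in>F. cnj (c i) * (c j * ip (e i) (e j)))"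
    by (simp only: ip_sum_left) (simp only: ip_sum_right ip_scale_left ip_scale_right mult.left_commute)
  also have "\<dots> = (\<Sum>i\<in>F. \<Sum>j\<in>F. if i = j then cnj (c i) * c i else 0)"
    using assms(2) by (intro sum.cong refl) auto
  also have "\<dots> = (\<Sum>i\<in>F. cnj (c i) * c i)"
    using assms(1) by simp
  also have "\<dots> = (\<Sum>i\<in>F. complex_of_real ((cmod (c i))\<^sup>2))"
    by (simp only: complex_norm_square mult.commute)
  finally show ?thesis
    by (simp add: ip_norm_power2)
qed

lemma diagonal_ip_norm_le:
  assumes G: "Vector_Spaces.linear cscale cscale G"
    and orth: "\<And>i j. i \<in> L \<Longrightarrow> j \<in> L \<Longrightarrow> ip (e i) (e j) = (if i = j then 1 else 0)"
    and eig: "\<And>i. i \<in> L \<Longrightarrow> G (e i) = cscale (l i) (e i)"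
    and r: "\<And>i. i \<in> L \<Longrightarrow> cmod (l i) \<le> r" "0 \<le> r"
    and u: "u \<in> span (e ` L)"
  shows "ip_norm ip (G u) \<le> r * ip_norm ip u"
proof -
  obtain F c where F: "finite F" "F \<subseteq> L" and u: "u = (\<Sum>i\<in>F. cscale (c i) (e i))"
    using span_image_eq_sum[OF u] by blast
  have orthF: "ip (e i) (e j) = (if i = j then 1 else 0)" if "i \<in> F" "j \<in> F" for i j
    using orth that F(2) by blast
  have "G u = (\<Sum>i\<in>F. cscale (c i * l i) (e i))"
    unfolding u linear_map_sum[OF G] using F(2) by (intro sum.cong) (auto simp: eig)
  then have "(ip_norm ip (G u))\<^sup>2 = (\<Sum>i\<in>F. (cmod (c i * l i))\<^sup>2)"
    using ip_norm_orthonormal_sum[OF F(1) orthF] by simp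
  also have "\<dots> \<le> (\<Sum>i\<in>F. r\<^sup>2 * (cmod (c i))\<^sup>2)"
  proof (rule sum_mono)
    fix i assume "i \<in> F"
    then have "(cmod (l i))\<^sup>2 \<le> r\<^sup>2"
      using F(2) r(1) by (intro power_mono) auto
    then have "(cmod (l i))\<^sup>2 * (cmod (c i))\<^sup>2 \<le> r\<^sup>2 * (cmod (c i))\<^sup>2"
      by (rule mult_right_mono) simp
    then show "(cmod (c i * l i))\<^sup>2 \<le> r\<^sup>2 * (cmod (c i))\<^sup>2"
      by (simp add: norm_mult power_mult_distrib mult.commute)
  qed
  also have "\<dots> = (r * ip_norm ip u)\<^sup>2"
    using ip_norm_orthonormal_sum[OF F(1) orthF, of c]
    by (simp add: u power_mult_distrib sum_distrib_left)
  finally show ?thesis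
    by (rule power2_le_imp_le) (simp add: r(2))
qed

text \<open>
  The set \<open>J\<close> indexes the invariant subspace on which \<open>S\<close> is nilpotent, and \<open>i0\<close> is an index
  outside \<open>J\<close> at which the remaining eigenvalues attain their largest modulus. The exponent shift by
  \<open>K\<close> is the price for annihilating the component of \<open>S\<^sup>n v\<close> in the subspace, about which nothing
  quantitative is known.
\<close>

lemma op_norm_funpow_two_sided:
  assumes S: "Vector_Spaces.linear cscale cscale S"
    and G: "Vector_Spaces.linear cscale cscale G"
    and basis: "orthonormal_basis cscale ip I e"
    and J: "J \<subseteq> I"
    and i0: "i0 \<in> I - J"
    and eig: "\<And>i. i \<in> I \<Longrightarrow> G (e i) = cscale (l i) (e i)"
    and max: "\<And>i. i \<in> I - J \<Longrightarrow> cmod (l i) \<le> cmod (l i0)"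
    and diff: "\<And>x. S x - G x \<in> span (e ` J)"
    and nil: "\<And>w. w \<in> span (e ` J) \<Longrightarrow> (S ^^ K) w = 0"
    and bdd: "bounded_op ip S"
  obtains C where "0 < C" "\<And>n. cmod (l i0) ^ n \<le> op_norm ip (S ^^ n)"
    "\<And>n. op_norm ip (S ^^ (n + K)) \<le> C * cmod (l i0) ^ n"
proof -
  let ?W = "span (e ` J)" and ?U = "span (e ` (I - J))" and ?r = "cmod (l i0)"
  have orth: "ip (e i) (e j) = (if i = j then 1 else 0)" if "i \<in> I" "j \<in> I" for i j
    using basis that by (auto simp: orthonormal_basis_def)
  have dense: "Metric_space.mtopology UNIV (ip_dist ip) closure_of (span (e ` I)) = UNIV"
    using basis by (auto simp: orthonormal_basis_def)
  have UW: "ip u w = 0" if "u \<in> ?U" "w \<in> ?W" for u w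
    by (rule ip_span_eq_0[OF _ that]) (use J orth in auto)
  obtain C where C: "0 < C" "\<And>v. ip_norm ip (S v) \<le> C * ip_norm ip v"
    using bdd by (rule bounded_op_pos) blast
  have Cn: "ip_norm ip ((S ^^ n) v) \<le> C ^ n * ip_norm ip v" for n v
    by (rule ip_norm_funpow_le[where U = UNIV]) (use C in auto)
  have G_span: "G x \<in> span (e ` H)" if "H \<subseteq> I" "x \<in> span (e ` H)" for x H
  proof (rule linear_span_invariant[OF G _ that(2)])
    fix b assume "b \<in> e ` H"
    then obtain i where "i \<in> H" and b: "b = e i"
      by blast
    then have "G b = cscale (l i) b"
      using eig that(1) by blast
    then show "G b \<in> span (e ` H)"
      using \<open>b \<in> e ` H\<close> by (simp add: span_scale span_base)
  qed
  have SW: "S w \<in> ?W" if "w \<in> ?W" for w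
    using span_add[OF diff[of w] G_span[OF J that]] by simp
  have mod_W: "(S ^^ n) x - (G ^^ n) x \<in> ?W" for n x
    by (rule funpow_diff_in_span[OF S diff SW])
  have e0: "e i0 \<in> ?U" and unit: "ip_norm ip (e i0) = 1"
    using i0 orth by (auto simp: ip_norm_def intro: span_base)
  have lower: "?r ^ n \<le> op_norm ip (S ^^ n)" for n
  proof -
    have Gn: "(G ^^ n) (e i0) = cscale (l i0 ^ n) (e i0)"
      by (induction n) (use i0 in \<open>auto simp: linear_map_scale[OF G] eig mult.commute\<close>)
    \<comment> \<open>Subtracting from \<open>S\<^sup>n e\<^sub>i\<^sub>0\<close> its component in the subspace, which is orthogonal to the rest, does
      not increase the norm.\<close>
    have "?r ^ n = ip_norm ip ((G ^^ n) (e i0))"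
      by (simp add: Gn ip_norm_scale unit norm_power)
    also have "\<dots> \<le> ip_norm ip ((S ^^ n) (e i0) - (G ^^ n) (e i0) + (G ^^ n) (e i0))"
      by (intro ip_norm_le_orthogonal_add UW mod_W) (auto simp: Gn intro: span_scale e0)
    also have "\<dots> = ip_norm ip ((S ^^ n) (e i0))"
      by simp
    also have "\<dots> \<le> op_norm ip (S ^^ n)"
      by (rule le_op_norm[OF Cn unit])
    finally show ?thesis .
  qed
  have upper: "op_norm ip (S ^^ (n + K)) \<le> C ^ K * ?r ^ n" for n
  proof (rule op_norm_le[OF bound_on_dense_extends[OF linear_funpow[OF S] Cn _ dense] unit])
    fix s assume "s \<in> span (e ` I)"
    also have "e ` I = e ` J \<union> e ` (I - J)"
      using J by blast
    finally obtain w u where s: "s = w + u" and w: "w \<in> ?W" and u: "u \<in> ?U"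
      unfolding span_Un by blast
    interpret Sn: Vector_Spaces.linear cscale cscale "S ^^ n" by (rule linear_funpow[OF S])
    interpret SK: Vector_Spaces.linear cscale cscale "S ^^ K" by (rule linear_funpow[OF S])
    have "(S ^^ n) w \<in> ?W"
      by (rule funpow_invariant[OF SW w])
    then have "(S ^^ n) s - (G ^^ n) u \<in> ?W"
      using span_add[OF _ mod_W[of n u]] by (simp add: s Sn.add add_diff_eq)
    then have "(S ^^ K) ((S ^^ n) s) = (S ^^ K) ((G ^^ n) u)"
      using nil[of "(S ^^ n) s - (G ^^ n) u"] by (simp add: SK.diff)
    then have "ip_norm ip ((S ^^ (n + K)) s) = ip_norm ip ((S ^^ K) ((G ^^ n) u))"
      by (simp add: funpow_add add.commute[of n K])
    also have "\<dots> \<le> C ^ K * ip_norm ip ((G ^^ n) u)"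
      by (rule Cn)
    also have "ip_norm ip ((G ^^ n) u) \<le> ?r ^ n * ip_norm ip u"
    proof (rule ip_norm_funpow_le[where U = ?U])
      show "ip_norm ip (G v) \<le> ?r * ip_norm ip v" if "v \<in> ?U" for v
        by (rule diagonal_ip_norm_le[OF G _ _ _ _ that]) (use orth eig max in auto)
    qed (use G_span u in auto)
    also have "ip_norm ip u \<le> ip_norm ip s"
      unfolding s by (rule ip_norm_le_orthogonal_add[OF UW[OF u w]])
    finally show "ip_norm ip ((S ^^ (n + K)) s) \<le> C ^ K * ?r ^ n * ip_norm ip s"
      using C(1) by (simp add: mult.assoc mult_left_mono)
  qed (use C(1) in auto)
  show thesis
    using that[of "C ^ K"] C(1) lower upper by simp
qed

end

text \<open>
  The shift by \<open>K\<close> only changes the constant, from \<open>C\<close> to \<open>C / r\<^sup>K\<close>, and \<open>n\<close>-th roots of a positive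
  constant tend to \<open>1\<close>.
\<close>

lemma root_tendsto_of_two_sided_bound:
  fixes a :: "nat \<Rightarrow> real"
  assumes "0 < r" and "0 < C" and lower: "\<And>n. r ^ n \<le> a n"
    and upper: "\<And>n. a (n + K) \<le> C * r ^ n"
  shows "(\<lambda>n. root n (a n)) \<longlonglongrightarrow> r"
proof (rule tendsto_sandwich)
  define D where "D = C / r ^ K"
  have D: "0 < D"
    using assms(1,2) by (simp add: D_def)
  show "\<forall>\<^sub>F n in sequentially. r \<le> root n (a n)"
    using eventually_gt_at_top[of "0::nat"]
  proof eventually_elim
    case (elim n)
    then show ?case
      using real_root_le_mono[OF elim lower[of n]] real_root_power_cancel[OF elim, of r] assms(1)
      by simp
  qed
  show "\<forall>\<^sub>F n in sequentially. root n (a n) \<le> root n D * r"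
    using eventually_ge_at_top[of "Suc K"]
  proof eventually_elim
    case (elim n)
    have "a n \<le> C * r ^ (n - K)"
      using upper[of "n - K"] elim by simp
    also have "\<dots> = D * r ^ n"
      using elim assms(1) by (simp add: D_def power_diff)
    finally have "root n (a n) \<le> root n (D * r ^ n)"
      using elim by (intro real_root_le_mono) auto
    also have "\<dots> = root n D * root n (r ^ n)"
      by (rule real_root_mult)
    also have "root n (r ^ n) = r"
      using elim assms(1) by (intro real_root_power_cancel) auto
    finally show ?case .
  qed
  show "(\<lambda>n. root n D * r) \<longlonglongrightarrow> r"
    using tendsto_mult_right[OF LIMSEQ_root_const[OF D], of r] by simp
qed simp

section \<open>Nilpotency of the coefficient matrix\<close>

text \<open>
  Row \<open>j\<close> of the matrix holds the coordinates of the image of a basis vector, so it is the transpose of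
  the usual matrix of \<open>S\<close>; since powers commute with transposition, the rows of its powers still hold
  the coordinates for the iterates.
\<close>

lemma funpow_eq_coefficient_matrix_power:
  assumes S: "Vector_Spaces.linear cscale cscale S"
    and ind: "linearly_independent_family cscale {1..n} \<psi>"
    and inv: "\<And>j. j < n \<Longrightarrow> S (\<psi> (Suc j)) \<in> module.span cscale (\<psi> ` {1..n})"
    and j: "j < n"
  shows "(S ^^ k) (\<psi> (Suc j))
    = (\<Sum>l<n. cscale ((coefficient_matrix cscale \<psi> n S ^\<^sub>m k) $$ (j, l)) (\<psi> (Suc l)))"
proof -
  interpret S: Vector_Spaces.linear cscale cscale S by (rule S)
  let ?M = "coefficient_matrix cscale \<psi> n S"
  have M: "?M \<in> carrier_mat n n"
    by (simp add: coefficient_matrix_def)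
  have Mk: "?M ^\<^sub>m k \<in> carrier_mat n n" for k
    by (rule pow_carrier_mat[OF M])
  have step: "S (\<psi> (Suc l)) = (\<Sum>i<n. cscale (?M $$ (l, i)) (\<psi> (Suc i)))" if "l < n" for l
  proof -
    have "S (\<psi> (Suc l)) = (\<Sum>i=1..n. cscale (?M $$ (l, i - 1)) (\<psi> i))"
      using coefficient_matrix_expansion[where S = S and j = "Suc l",
          OF S.vs1.vector_space_axioms ind inv[OF that]] that by simp
    also have "\<dots> = (\<Sum>i<n. cscale (?M $$ (l, i)) (\<psi> (Suc i)))"
      by (simp add: sum.atLeast1_atMost_eq)
    finally show ?thesis .
  qed
  show ?thesis
  proof (induction k)
    case 0
    have "(\<Sum>l<n. cscale ((?M ^\<^sub>m 0) $$ (j, l)) (\<psi> (Suc l)))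
        = (\<Sum>l<n. if l = j then \<psi> (Suc l) else 0)"
      using j M by (intro sum.cong) auto
    then show ?case
      using j by simp
  next
    case (Suc k)
    have "(S ^^ Suc k) (\<psi> (Suc j)) = (\<Sum>l<n. cscale ((?M ^\<^sub>m k) $$ (j, l)) (S (\<psi> (Suc l))))"
      by (simp add: Suc linear_map_sum[OF S])
    also have "\<dots> = (\<Sum>l<n. \<Sum>i<n. cscale ((?M ^\<^sub>m k) $$ (j, l) * ?M $$ (l, i)) (\<psi> (Suc i)))"
      by (intro sum.cong refl) (simp add: step S.vs1.scale_sum_right)
    also have "\<dots> = (\<Sum>i<n. \<Sum>l<n. cscale ((?M ^\<^sub>m k) $$ (j, l) * ?M $$ (l, i)) (\<psi> (Suc i)))"
      by (rule sum.swap)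
    also have "\<dots> = (\<Sum>i<n. cscale ((?M ^\<^sub>m Suc k) $$ (j, i)) (\<psi> (Suc i)))"
      using j M Mk[of k]
      by (intro sum.cong refl)
        (auto simp: scalar_prod_def S.vs1.scale_sum_left lessThan_atLeast0 intro!: sum.cong)
    finally show ?case .
  qed
qed

lemma nilpotent_coefficient_matrix_imp_funpow_eq_0:
  assumes S: "Vector_Spaces.linear cscale cscale S"
    and ind: "linearly_independent_family cscale {1..n} \<psi>"
    and inv: "\<And>j. j < n \<Longrightarrow> S (\<psi> (Suc j)) \<in> module.span cscale (\<psi> ` {1..n})"
    and nil: "nilpotent_mat (coefficient_matrix cscale \<psi> n S)"
  obtains K where "\<And>w. w \<in> module.span cscale (\<psi> ` {1..n}) \<Longrightarrow> (S ^^ K) w = 0"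
proof -
  interpret S: Vector_Spaces.linear cscale cscale S by (rule S)
  let ?M = "coefficient_matrix cscale \<psi> n S"
  obtain K where K: "?M ^\<^sub>m K = 0\<^sub>m n n"
    using nil by (auto simp: nilpotent_mat_def coefficient_matrix_def)
  have basis: "(S ^^ K) (\<psi> (Suc j)) = 0" if "j < n" for j
    using funpow_eq_coefficient_matrix_power[OF S ind inv that, of K] that by (simp add: K)
  interpret SK: Vector_Spaces.linear cscale cscale "S ^^ K" by (rule linear_funpow[OF S])
  have image: "(S ^^ K) b = 0" if "b \<in> \<psi> ` {1..n}" for b
    using that basis by (auto simp: Suc_le_eq dest!: gr0_implies_Suc)
  have "(S ^^ K) w = 0" if "w \<in> S.vs1.span (\<psi> ` {1..n})" for w
    using that
    by (induction rule: S.vs1.span_induct_alt) (simp_all add: SK.add SK.scale SK.zero image)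
  then show thesis
    by (rule that)
qed

section \<open>The two-level operator\<close>

context complex_inner_product_space
begin

lemma linear_prolongation:
  fixes p :: "'m::finite \<Rightarrow> 'a"
  shows "Vector_Spaces.linear (*s) cscale (prolongation cscale p)"
  unfolding Vector_Spaces.linear_iff
proof (intro conjI allI)
  fix v w :: "complex ^ 'm" and c
  show "prolongation cscale p (v + w) = prolongation cscale p v + prolongation cscale p w"
    by (simp add: prolongation_def scale_left_distrib sum.distrib)
  show "prolongation cscale p (c *s v) = cscale c (prolongation cscale p v)"
    by (simp add: prolongation_def scale_sum_right)
qed (rule vec.vector_space_axioms vector_space_axioms)+

lemma linear_restriction:
  "Vector_Spaces.linear cscale (*s) (restriction ip p)"
  unfolding Vector_Spaces.linear_iff
proof (intro conjI allI)
  fix x y c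
  show "restriction ip p (x + y) = restriction ip p x + restriction ip p y"
    by (simp add: restriction_def ip_add_right Finite_Cartesian_Product.vec_eq_iff)
  show "restriction ip p (cscale c x) = c *s restriction ip p x"
    by (simp add: restriction_def ip_scale_right Finite_Cartesian_Product.vec_eq_iff)
qed (rule vec.vector_space_axioms vector_space_axioms)+

lemma range_prolongation: "range (prolongation cscale p) = span (range p)"
proof
  show "range (prolongation cscale p) \<subseteq> span (range p)"
    unfolding prolongation_def by (intro image_subsetI span_sum span_scale span_base rangeI)
  show "span (range p) \<subseteq> range (prolongation cscale p)"
  proof
    fix x assume "x \<in> span (range p)"
    then show "x \<in> range (prolongation cscale p)"
    proof (induction rule: span_induct_alt)
      case base
      have "prolongation cscale p 0 = 0"
        by (simp add: prolongation_def)
      then show ?case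
        by (metis rangeI)
    next
      case (step c x y)
      then obtain k v where x: "x = p k" and y: "y = prolongation cscale p v"
        by blast
      have "prolongation cscale p (axis k c) = (\<Sum>i\<in>UNIV. if i = k then cscale c (p k) else 0)"
        unfolding prolongation_def by (intro sum.cong) (auto simp: axis_def)
      then have "prolongation cscale p (axis k c + v) = cscale c x + y"
        by (simp add: linear_map_add[OF linear_prolongation] x y)
      then show ?case
        by (metis rangeI)
    qed
  qed
qed

lemma linear_two_level_op:
  assumes A: "Vector_Spaces.linear cscale cscale A"
    and G: "Vector_Spaces.linear cscale cscale G"
  shows "Vector_Spaces.linear cscale cscale (two_level_op cscale ip p A G)"
proof -
  note P = linear_prolongation[of p] and R = linear_restriction[of p]
  show ?thesis
    unfolding Vector_Spaces.linear_iff two_level_op_def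
  proof (intro conjI allI vector_space_axioms, goal_cases)
    case (1 x y)
    then show ?case
      by (simp add: linear_map_add[OF A] linear_map_add[OF G] linear_map_add[OF P]
          linear_map_add[OF R] matrix_vector_right_distrib)
  next
    case (2 c x)
    then show ?case
      by (simp add: linear_map_scale[OF A] linear_map_scale[OF G] linear_map_scale[OF P]
          linear_map_scale[OF R] vector_scalar_commute scale_right_diff_distrib)
  qed
qed

lemma two_level_op_diff_in_span: "two_level_op cscale ip p A G x - G x \<in> span (range p)"
  using range_prolongation[of p] by (auto simp: two_level_op_def intro!: span_neg)

text \<open>
  The coarse correction \<open>P A\<^sub>c\<inverse> R A\<close> fixes every \<open>P v\<close>, because \<open>R A P = A\<^sub>c\<close>; so it cancels \<open>G x\<close> whenever
  \<open>G x\<close> lies in the coarse space.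
\<close>

lemma two_level_op_eq_0:
  assumes A: "Vector_Spaces.linear cscale cscale A"
    and inv: "invertible (coarse_matrix cscale ip p A)"
    and x: "G x \<in> span (range p)"
  shows "two_level_op cscale ip p A G x = 0"
proof -
  let ?P = "prolongation cscale p" and ?R = "restriction ip p" and ?Ac = "coarse_matrix cscale ip p A"
  obtain v where v: "G x = ?P v"
    using x range_prolongation[of p] by blast
  have "Vector_Spaces.linear (*s) (*s) (?R \<circ> A \<circ> ?P)"
    by (rule Vector_Spaces.linear_compose[OF linear_prolongation
          Vector_Spaces.linear_compose[OF A linear_restriction]])
  then have "?R (A (?P v)) = ?Ac *v v"
    by (simp add: coarse_matrix_def matrix_works)
  moreover have "matrix_inv ?Ac ** ?Ac = Finite_Cartesian_Product.mat 1"
    using inv unfolding invertible_def matrix_inv_def by (rule someI2_ex) simp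
  ultimately have "matrix_inv ?Ac *v ?R (A (G x)) = v"
    by (simp add: v matrix_vector_mul_assoc)
  then show ?thesis
    by (simp add: two_level_op_def v)
qed

end

theorem theorem4p3:
  fixes cscale :: "complex \<Rightarrow> 'a::ab_group_add \<Rightarrow> 'a"
    and ip ipX :: "'a \<Rightarrow> 'a \<Rightarrow> complex"
    and A G T :: "'a \<Rightarrow> 'a"
    and p :: "'m::finite \<Rightarrow> 'a"
    and Vc :: "'a set"
    and \<psi> :: "nat \<Rightarrow> 'a"
    and lamA lam :: "nat \<Rightarrow> complex"
    and mt :: nat
  defines "Vc \<equiv> module.span cscale (range p)"
    and "T \<equiv> two_level_op cscale ip p A G"
  assumes X: "complex_inner_product_space cscale ip"
    and A_linear: "Vector_Spaces.linear cscale cscale A" and A_bij: "bij A"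
    and G_linear: "Vector_Spaces.linear cscale cscale G"
    and H1_independent: "linearly_independent_family cscale UNIV p"
    and H1_invertible: "invertible (coarse_matrix cscale ip p A)"
    and H2_independent: "linearly_independent_family cscale {1..} \<psi>"
    and H2_A: "\<And>k. 1 \<le> k \<Longrightarrow> A (\<psi> k) = cscale (lamA k) (\<psi> k)"
    and H2_G: "\<And>k. 1 \<le> k \<Longrightarrow> G (\<psi> k) = cscale (lam k) (\<psi> k)"
    and H3_range: "\<And>k. 1 \<le> k \<Longrightarrow> cmod (lam k) \<in> {0<..<1}"
    and H3_decreasing: "\<And>k. 2 \<le> k \<Longrightarrow> cmod (lam k) \<le> cmod (lam (k - 1))"
    and H4_index: "CARD('m) \<le> mt"
    and H4_subset: "Vc \<subseteq> module.span cscale (\<psi> ` {1..mt})"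
    and H4_inter: "Vc \<inter> module.span cscale (\<psi> ` {mt + 1..}) = {0}"
    and hilbert: "complex_hilbert_space cscale ipX"
    and basis: "orthonormal_basis cscale ipX {1..} \<psi>"
    and A_bounded: "bounded_op ipX A" and A_self_adjoint: "self_adjoint_op ipX A"
    and G_bounded: "bounded_op ipX G" and G_self_adjoint: "self_adjoint_op ipX G"
    and T_bounded: "bounded_op ipX T"
  shows "(Vc = module.span cscale (\<psi> ` {1..mt}) \<longrightarrow>
            nilpotent_mat (coefficient_matrix cscale \<psi> mt T)) \<and>
         (nilpotent_mat (coefficient_matrix cscale \<psi> mt T) \<longrightarrow>
            (\<lambda>n. root n (op_norm ipX (T ^^ n))) \<longlonglongrightarrow> cmod (lam (mt + 1)) \<and>
            cmod (lam (mt + 1)) < 1)"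
proof -
  interpret X: complex_inner_product_space cscale ip by (rule X)
  interpret H: complex_hilbert_space cscale ipX by (rule hilbert)
  let ?W = "X.span (\<psi> ` {1..mt})" and ?M = "coefficient_matrix cscale \<psi> mt T"
  have T: "Vector_Spaces.linear cscale cscale T"
    unfolding T_def by (rule X.linear_two_level_op[OF A_linear G_linear])
  have T_diff: "T x - G x \<in> ?W" for x
    using X.two_level_op_diff_in_span[of p A G x] H4_subset unfolding T_def Vc_def by blast
  have G_psi: "G (\<psi> k) \<in> ?W" if "k \<in> {1..mt}" for k
    using that H2_G[of k] X.span_scale[OF X.span_base[OF imageI[OF that]]] by simp
  have T_psi: "T (\<psi> k) \<in> ?W" if "k \<in> {1..mt}" for k
    using X.span_add[OF T_diff[of "\<psi> k"] G_psi[OF that]] by simp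
  have ind: "linearly_independent_family cscale {1..mt} \<psi>"
  proof -
    have "{1..mt} \<subseteq> {1..}"
      by auto
    then show ?thesis
      using H2_independent inj_on_subset[of \<psi> "{1..}" "{1..mt}"]
        X.independent_mono[of "\<psi> ` {1..}" "\<psi> ` {1..mt}"] image_mono[of "{1..mt}" "{1..}" \<psi>]
      unfolding linearly_independent_family_def by blast
  qed
  have lam_antimono: "cmod (lam k) \<le> cmod (lam (mt + 1))" if "mt + 1 \<le> k" for k
    using that
  proof (induction k rule: dec_induct)
    case (step k)
    then show ?case
      using H3_decreasing[of "Suc k"] by simp
  qed simp
  have lam: "0 < cmod (lam (mt + 1))" "cmod (lam (mt + 1)) < 1"
    using H3_range[of "mt + 1"] by auto

  have "nilpotent_mat ?M" if "Vc = ?W"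
  proof -
    have "T (\<psi> k) = 0" if "k \<in> {1..mt}" for k
      unfolding T_def
      by (rule X.two_level_op_eq_0[OF A_linear H1_invertible])
        (use G_psi[OF that] \<open>Vc = ?W\<close> in \<open>simp add: Vc_def\<close>)
    then have "?M ^\<^sub>m 1 = 0\<^sub>m (dim_row ?M) (dim_row ?M)"
      by (intro eq_matI) (auto simp: coefficient_matrix_def X.representation_zero)
    then show ?thesis
      unfolding nilpotent_mat_def by blast
  qed
  moreover have "(\<lambda>n. root n (op_norm ipX (T ^^ n))) \<longlonglongrightarrow> cmod (lam (mt + 1))"
    if nil: "nilpotent_mat ?M"
  proof -
    obtain K where K: "\<And>w. w \<in> ?W \<Longrightarrow> (T ^^ K) w = 0"
      by (rule nilpotent_coefficient_matrix_imp_funpow_eq_0[OF T ind _ nil]) (use T_psi in auto)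
    obtain C where "0 < C" "\<And>n. cmod (lam (mt + 1)) ^ n \<le> op_norm ipX (T ^^ n)"
      "\<And>n. op_norm ipX (T ^^ (n + K)) \<le> C * cmod (lam (mt + 1)) ^ n"
    proof (rule H.op_norm_funpow_two_sided[OF T G_linear basis, where J = "{1..mt}" and l = lam
          and ?i0.0 = "mt + 1" and K = K])
    qed (use H2_G lam_antimono T_diff K T_bounded in auto)
    then show ?thesis
      by (rule root_tendsto_of_two_sided_bound[OF lam(1)])
  qed
  ultimately show ?thesis
    using lam(2) by blast
qed

end
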